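(* Let $A$ be a commutative ring and let $C$ be an ideal of $A$ with $C\neq 0$. Then $C$ is coprime if and only if $C\operatorname{Ann}(I)=C$ for every ideal $I$ of $A$ with $C\not\subseteq I$.
   Context: All rings are commutative with identity. For ideals $I,J$ of a ring $A$, $\operatorname{Ann}(I)=\{a\in A\mid aI=0\}$ and $(J:I)=\{a\in A\mid aI\subseteq J\}$. The coproduct of $I$ and $J$ is the ideal $[I:J]:=(J:\operatorname{Ann}(I))=\{a\in A\mid a\operatorname{Ann}(I)\subseteq J\}$. An ideal $C$ of $A$ is coprime if $C\neq 0$ and, for all ideals $I,J$ of $A$, $C\subseteq [I:J]$ implies $C\subseteq I$ or $C\subseteq J$. *)

theory Defs
  imports "HOL-Algebra.Ideal_Product"
begin

definition annihilator :: "('a, 'b) ring_scheme \<Rightarrow> 'a set \<Rightarrow> 'a set"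
  where "annihilator A I = {a \<in> carrier A. \<forall>x\<in>I. a \<otimes>\<^bsub>A\<^esub> x = \<zero>\<^bsub>A\<^esub>}"

definition ideal_quotient :: "('a, 'b) ring_scheme \<Rightarrow> 'a set \<Rightarrow> 'a set \<Rightarrow> 'a set"
  where "ideal_quotient A J I = {a \<in> carrier A. \<forall>x\<in>I. a \<otimes>\<^bsub>A\<^esub> x \<in> J}"

(* [I : J] = (J : Ann(I)) *)
definition ideal_coproduct :: "('a, 'b) ring_scheme \<Rightarrow> 'a set \<Rightarrow> 'a set \<Rightarrow> 'a set"
  where "ideal_coproduct A I J = ideal_quotient A J (annihilator A I)"

(* Dual of a prime ideal; unrelated to comaximality (C + D = A) of two ideals. *)
definition coprime_ideal :: "('a, 'b) ring_scheme \<Rightarrow> 'a set \<Rightarrow> bool"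
  where "coprime_ideal A C \<longleftrightarrow>
    ideal C A \<and> C \<noteq> {\<zero>\<^bsub>A\<^esub>} \<and>
    (\<forall>I J. ideal I A \<longrightarrow> ideal J A \<longrightarrow>
      C \<subseteq> ideal_coproduct A I J \<longrightarrow> C \<subseteq> I \<or> C \<subseteq> J)"

end

theory Submission
  imports Defs
begin

text \<open>The coproduct is a colon ideal, so colon and product are adjoint: C lies in [I : J]
  exactly when C Ann(I) lies in J (\<open>subset_ideal_coproduct_iff\<close>). For fixed I,
  coprimality therefore says that, if C is not inside I, every ideal J containing C Ann(I) contains
  C. The smallest such J is C Ann(I) itself, an ideal because Ann(I) is one
  (\<open>annihilator_is_ideal\<close>), so the condition amounts to C \<subseteq> C Ann(I). The
  reverse inclusion always holds, which turns this into an equality.\<close>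

lemma (in cring) annihilator_is_ideal:
  assumes "ideal I R"
  shows "ideal (annihilator R I) R"
proof -
  interpret I: ideal I R by fact
  have [simp]: "x \<in> carrier R" if "x \<in> I" for x
    using that I.Icarr by blast
  show ?thesis
  proof (rule idealI)
    show "ring R" by (rule ring_axioms)
  next
    show "subgroup (annihilator R I) (add_monoid R)"
    proof (rule subgroup.intro)
      fix a assume a: "a \<in> annihilator R I"
      then have "inv\<^bsub>add_monoid R\<^esub> a = \<ominus> a" by (simp add: a_inv_def)
      with a show "inv\<^bsub>add_monoid R\<^esub> a \<in> annihilator R I"
        by (simp add: annihilator_def l_minus)
    qed (auto simp: annihilator_def l_distr)
  next
    fix a x assume "a \<in> annihilator R I" and "x \<in> carrier R"
    then show "x \<otimes> a \<in> annihilator R I" and "a \<otimes> x \<in> annihilator R I"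
      by (simp_all add: annihilator_def m_assoc m_comm[of a x])
  qed
qed

text \<open>Membership in the coproduct only tests single products c a with a in Ann(I). Since J is
  closed under addition, it then contains all finite sums of them, which make up the ideal
  product.\<close>

lemma (in ring) subset_ideal_coproduct_iff:
  assumes "C \<subseteq> carrier R" and "ideal J R"
  shows "C \<subseteq> ideal_coproduct R I J \<longleftrightarrow> C \<cdot> annihilator R I \<subseteq> J"
proof
  interpret J: ideal J R by fact
  assume *: "C \<subseteq> ideal_coproduct R I J"
  have "x \<in> J" if "x \<in> C \<cdot> annihilator R I" for x
    using that
  proof (induction rule: ideal_prod.induct)
    case (prod c a)
    then show ?case
      using * by (auto simp: ideal_coproduct_def ideal_quotient_def)
  next
    case (sum s t)
    then show ?case by simp
  qed
  then show "C \<cdot> annihilator R I \<subseteq> J" by blast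
next
  assume "C \<cdot> annihilator R I \<subseteq> J"
  then show "C \<subseteq> ideal_coproduct R I J"
    using assms(1) unfolding ideal_coproduct_def ideal_quotient_def
    by (blast intro: ideal_prod.prod)
qed

theorem lemma1:
  fixes A :: "('a, 'b) ring_scheme" and C :: "'a set"
  assumes "cring A"
    and "ideal C A"
    and "C \<noteq> {\<zero>\<^bsub>A\<^esub>}"
  shows "coprime_ideal A C \<longleftrightarrow>
    (\<forall>I. ideal I A \<longrightarrow> \<not> C \<subseteq> I \<longrightarrow> C \<cdot>\<^bsub>A\<^esub> annihilator A I = C)"
proof -
  interpret cring A by fact
  interpret C: ideal C A by fact
  have le: "C \<cdot>\<^bsub>A\<^esub> annihilator A I \<subseteq> C" if "ideal I A" for I
    using ideal_prod_inter[OF assms(2) annihilator_is_ideal[OF that]] by blast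
  have prod: "ideal (C \<cdot>\<^bsub>A\<^esub> annihilator A I) A" if "ideal I A" for I
    using ideal_prod_is_ideal[OF assms(2) annihilator_is_ideal[OF that]] .
  note coproduct = subset_ideal_coproduct_iff[OF C.a_subset]
  show ?thesis
  proof (intro iffI allI impI)
    fix I assume "coprime_ideal A C" and I: "ideal I A" and "\<not> C \<subseteq> I"
    \<comment> \<open>Coprimality is tested at the least possible J, namely C Ann(I), where the
      adjunction reduces the premise to a trivial inclusion.\<close>
    moreover have "C \<subseteq> ideal_coproduct A I (C \<cdot>\<^bsub>A\<^esub> annihilator A I)"
      using coproduct[OF prod[OF I]] by simp
    ultimately have "C \<subseteq> C \<cdot>\<^bsub>A\<^esub> annihilator A I"
      unfolding coprime_ideal_def using prod[OF I] by blast
    with le[OF I] show "C \<cdot>\<^bsub>A\<^esub> annihilator A I = C" by simp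
  next
    assume *: "\<forall>I. ideal I A \<longrightarrow> \<not> C \<subseteq> I \<longrightarrow> C \<cdot>\<^bsub>A\<^esub> annihilator A I = C"
    \<comment> \<open>If C is not inside I, then \<open>*\<close> gives C = C Ann(I), and the
      adjunction places this product inside J.\<close>
    have "C \<subseteq> I \<or> C \<subseteq> J"
      if "ideal I A" and "ideal J A" and "C \<subseteq> ideal_coproduct A I J" for I J
      using * that coproduct[of J I] by auto
    with assms(2,3) show "coprime_ideal A C"
      by (simp add: coprime_ideal_def)
  qed
qed

end
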